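(* Let $\mathcal O$ be a finite set of objects, let $N=(P,T,F,pt,F_{var},\ell)$ be an accepting OCPN (with play places $P_{\mathrm{play}}$ and stop places $P_{\mathrm{stop}}$ as described in the context), let $N'=\mathbb T_1(N)$, and let $M_\emptyset$ denote the empty marking of $N'$. Then there exists a run of $N$ $$M_0 \xrightarrow{(t_1,b_1)} M_1 \xrightarrow{(t_2,b_2)} \cdots \xrightarrow{(t_n,b_n)} M_n$$ with $M_0=M_{\mathit{init}}^{\mathcal O}$ and $M_n=M_{\mathit{final}}^{\mathcal O}$ if and only if there is a run of $N'$ over the set of objects $\mathcal O$ $$M_\emptyset \xrightarrow{*} M_0' \xrightarrow{(t_1,\beta_1)} M_1' \xrightarrow{(t_2,\beta_2)} \cdots \xrightarrow{(t_n,\beta_n)} M_n' \xrightarrow{*} M_\emptyset$$ such that $M_i'=\mathbb T_1(M_i)$ for all $0\le i\le n$ and $\beta_i=\mathbb T_1(b_i)$ for all $1\le i\le n$, where $M_\emptyset \xrightarrow{*} M_0'$ is an emitting sequence, $M_n'\xrightarrow{*} M_\emptyset$ is a collapsing sequence, and no emitting or consuming transitions occur in between.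
   Context: Object-centric Petri nets (OCPN). Fix a set of object types $\Sigma$, a set of activities $\mathcal A$, and a set of objects, each object $o$ having a type $ot(o)\in\Sigma$. An OCPN is $N=(P,T,F,pt,F_{var},\ell)$ with finite disjoint sets of places $P$ and transitions $T$, flow relation $F\subseteq (P\times T)\cup(T\times P)$, place typing $pt:P\to\Sigma$, variable arcs $F_{var}\subseteq F$, and labelling $\ell:T\to\mathcal A\cup\{\tau\}$. Write ${}^\bullet t=\{p\mid (p,t)\in F\}$, $t^\bullet=\{p\mid (t,p)\in F\}$; $tpl(t)$ is the set of types of places in ${}^\bullet t\cup t^\bullet$, $tpl_{var}(t)$ the types of those places connected to $t$ by arcs in $F_{var}$, $tpl_{nv}(t)$ those connected by arcs in $F\setminus F_{var}$; it is assumed $tpl_{var}(t)\cap tpl_{nv}(t)=\emptyset$ for all $t$. Let $Q=\{(p,o)\mid pt(p)=ot(o)\}$; a marking is $M:Q\to\{0,1\}$. A binding execution is a pair $(t,b)$ with $b$ a function from $tpl(t)$ to sets of objects (of the respective type) such that $|b(\sigma)|=1$ for $\sigma\in tpl_{nv}(t)$. Let $cons(t,b)=\{(p,o)\mid p\in{}^\bullet t, o\in b(pt(p))\}$ and $prod(t,b)=\{(p,o)\mid p\in t^\bullet, o\in b(pt(p))\}$; $(t,b)$ is enabled in $M$ if $cons(t,b)\le M$, and firing yields $M-cons(t,b)+prod(t,b)$, written $M\xrightarrow{(t,b)}M'$. An accepting OCPN comes with sets of play places $P_{\mathrm{play}}\subseteq P$ and stop places $P_{\mathrm{stop}}\subseteq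 P$ containing, for each $\sigma\in\Sigma$, exactly one place of type $\sigma$ each. For a finite set of objects $O$, $M_{\mathit{init}}^O$ (resp. $M_{\mathit{final}}^O$) is the marking with $M(p_\sigma,o)=1$ for each $o\in O$ of type $\sigma$, where $p_\sigma$ is the play (resp. stop) place of type $\sigma$, and $0$ elsewhere. Object-centric Petri nets with identifiers (OPID). Assume a set $X$ of object variables, a set $X_{list}$ of list variables, and a set $\Upsilon$ of fresh-object variables, each typed by $\Sigma$ (list variables by list types). An inscription is a tuple $\langle x_1,\dots,x_m\rangle$ of variables with at most one list variable. An OPID is $(\Sigma,P,T,F_{in},F_{out},\mathrm{color},\ell)$ where each place has a color (a tuple of types), $F_{in}:P\times T\to$ inscriptions and $F_{out}:T\times P\to$ inscriptions are partial functions whose inscription colors match place colors, with no fresh variables on input arcs and output variables among input variables or fresh variables. A marking assigns to each place a set of object tuples of its color. A binding $\beta$ for transition $t$ in marking $M$ is a type-preserving map from the variables on $t$'s arcs to objects (list variables to lists of objects), injective on fresh variables, with fresh variables mapped to objects not occurring in $M$. For an inscription $\iota=\langle x_1,\dots,x_m\rangle$, $\vec\beta(\iota)=\{\langle\beta(x_1),\dots,\beta(x_m)\rangle\}$ if there is no list variable; if $x_i$ is a list variable with $\beta(x_i)=[u_1,\dots,u_k]$ then $\vec\beta(\iota)$ is the set of the $k$ tuples obtained by replacing position $i$ by $u_j$. $t$ is enabled with $\beta$ in $M$ if $\vec\beta(F_{in}(p,t))\subseteq M(p)$ for all input places $p$; firing yields $M'(p)=M(p)\setminus\vec\beta(F_{in}(p,t))\cup\vec\beta(F_{out}(t,p))$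 (with the removal only for input places and addition only for output places). A run is over the set of objects $\mathcal O$ if all bindings take values in $\mathcal O$ (and lists over $\mathcal O$). The mapping $\mathbb T_1$. For each $\sigma\in\Sigma$ fix variables $x_\sigma\in X$, $X_\sigma\in X_{list}$ of list type over $\sigma$, $\nu_\sigma\in\Upsilon$. $\mathbb T_1(N)$ has places $P$ with $\mathrm{color}(p)=\langle pt(p)\rangle$, transitions $T\cup T_e\cup T_c$ where $T_e=\{t_{e,\sigma}\mid\sigma\in\Sigma\}$ (emitting) and $T_c=\{t_{c,\sigma}\mid\sigma\in\Sigma\}$ (consuming) are new transitions labelled $\tau$ (other labels as in $N$); arcs: each $(t,p)$ or $(p,t)$ in $F\setminus F_{var}$ gets inscription $\langle x_{pt(p)}\rangle$, each in $F_{var}$ gets $\langle X_{pt(p)}\rangle$; $t_{e,\sigma}$ has an output arc $\langle\nu_\sigma\rangle$ to the play place of type $\sigma$; the stop place of type $\sigma$ has an input arc $\langle x_\sigma\rangle$ to $t_{c,\sigma}$. For an OCPN marking $M$, $\mathbb T_1(M)(p)=\{\langle o\rangle\mid M(p,o)>0\}$. For an OCPN binding $b$ of $t$, $\mathbb T_1(b)$ is the OPID binding $\beta$ with $\beta(x_\sigma)$ the unique element of $b(\sigma)$ when $|b(\sigma)|=1$, and otherwise $\beta(X_\sigma)$ a list containing the elements of $b(\sigma)$ in arbitrary order. An emitting sequence is a firing sequence using only transitions in $T_e$; a collapsing sequence uses only transitions in $T_c$.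
   Formalization: Assumes T_1(N) is an OPID (each transition's output-place types occur among its input-place types; else it is false); M−cons+prod is capped at 1; T_1(b) uses X_σ on variable arcs even if |b(σ)|=1; M_0=M_init and M_n=M_final are also required on the right side. *)

theory Defs
  imports Main
begin

text \<open>
  The set of object types is the type \<open>'s\<close>, the set of activities is \<open>'a\<close> (the label \<open>\<tau>\<close> is
  \<open>None\<close>), and the set of all objects is \<open>'o\<close>, typed by a function \<open>ot :: 'o \<Rightarrow> 's\<close>.
\<close>

section \<open>Object-centric Petri nets\<close>

record ('n, 's, 'a) ocpn =
  plc :: "'n set"
  trn :: "'n set"
  flow :: "('n \<times> 'n) set"
  ptype :: "'n \<Rightarrow> 's"
  vflow :: "('n \<times> 'n) set"
  lab :: "'n \<Rightarrow> 'a option"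
  play :: "'n set"
  stop :: "'n set"

definition pre :: "('n, 's, 'a) ocpn \<Rightarrow> 'n \<Rightarrow> 'n set" where
  "pre N t = {p. (p, t) \<in> flow N}"

definition post :: "('n, 's, 'a) ocpn \<Rightarrow> 'n \<Rightarrow> 'n set" where
  "post N t = {p. (t, p) \<in> flow N}"

definition tpl :: "('n, 's, 'a) ocpn \<Rightarrow> 'n \<Rightarrow> 's set" where
  "tpl N t = ptype N ` (pre N t \<union> post N t)"

definition tpl_var :: "('n, 's, 'a) ocpn \<Rightarrow> 'n \<Rightarrow> 's set" where
  "tpl_var N t = ptype N ` {p. (p, t) \<in> vflow N \<or> (t, p) \<in> vflow N}"

definition tpl_nv :: "('n, 's, 'a) ocpn \<Rightarrow> 'n \<Rightarrow> 's set" where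
  "tpl_nv N t = ptype N ` {p. (p, t) \<in> flow N - vflow N \<or> (t, p) \<in> flow N - vflow N}"

definition wf_ocpn :: "('n, 's, 'a) ocpn \<Rightarrow> bool" where
  "wf_ocpn N \<longleftrightarrow>
     finite (plc N) \<and> finite (trn N) \<and> plc N \<inter> trn N = {} \<and>
     flow N \<subseteq> plc N \<times> trn N \<union> trn N \<times> plc N \<and>
     vflow N \<subseteq> flow N \<and>
     (\<forall>t\<in>trn N. tpl_var N t \<inter> tpl_nv N t = {})"

definition accepting_ocpn :: "('n, 's, 'a) ocpn \<Rightarrow> bool" where
  "accepting_ocpn N \<longleftrightarrow>
     wf_ocpn N \<and> play N \<subseteq> plc N \<and> stop N \<subseteq> plc N \<and>
     (\<forall>\<sigma>. \<exists>!p. p \<in> play N \<and> ptype N p = \<sigma>) \<and>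
     (\<forall>\<sigma>. \<exists>!p. p \<in> stop N \<and> ptype N p = \<sigma>)"

definition play_place :: "('n, 's, 'a) ocpn \<Rightarrow> 's \<Rightarrow> 'n" where
  "play_place N \<sigma> = (THE p. p \<in> play N \<and> ptype N p = \<sigma>)"

definition stop_place :: "('n, 's, 'a) ocpn \<Rightarrow> 's \<Rightarrow> 'n" where
  "stop_place N \<sigma> = (THE p. p \<in> stop N \<and> ptype N p = \<sigma>)"

definition token_set :: "('o \<Rightarrow> 's) \<Rightarrow> ('n, 's, 'a) ocpn \<Rightarrow> ('n \<times> 'o) set" where
  "token_set ot N = {(p, obj). p \<in> plc N \<and> ptype N p = ot obj}"

text \<open>A marking on \<open>token_set ot N\<close> is extended by 0 to a total function.\<close>

definition ocpn_marking :: "('o \<Rightarrow> 's) \<Rightarrow> ('n, 's, 'a) ocpn \<Rightarrow> ('n \<times> 'o \<Rightarrow> nat) \<Rightarrow> bool" where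
  "ocpn_marking ot N M \<longleftrightarrow>
     (\<forall>q\<in>token_set ot N. M q \<in> {0, 1}) \<and> (\<forall>q. q \<notin> token_set ot N \<longrightarrow> M q = 0)"

text \<open>Only the values of \<open>b\<close> on \<open>tpl N t\<close> are relevant.\<close>

definition binding_execution ::
    "('o \<Rightarrow> 's) \<Rightarrow> ('n, 's, 'a) ocpn \<Rightarrow> 'n \<Rightarrow> ('s \<Rightarrow> 'o set) \<Rightarrow> bool" where
  "binding_execution ot N t b \<longleftrightarrow>
     t \<in> trn N \<and>
     (\<forall>\<sigma>\<in>tpl N t. b \<sigma> \<subseteq> {obj. ot obj = \<sigma>}) \<and>
     (\<forall>\<sigma>\<in>tpl_nv N t. card (b \<sigma>) = 1)"

definition cons_tokens :: "('n, 's, 'a) ocpn \<Rightarrow> 'n \<Rightarrow> ('s \<Rightarrow> 'o set) \<Rightarrow> ('n \<times> 'o) set" where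
  "cons_tokens N t b = {(p, obj). p \<in> pre N t \<and> obj \<in> b (ptype N p)}"

definition prod_tokens :: "('n, 's, 'a) ocpn \<Rightarrow> 'n \<Rightarrow> ('s \<Rightarrow> 'o set) \<Rightarrow> ('n \<times> 'o) set" where
  "prod_tokens N t b = {(p, obj). p \<in> post N t \<and> obj \<in> b (ptype N p)}"

definition ocpn_enabled ::
    "('n, 's, 'a) ocpn \<Rightarrow> ('n \<times> 'o \<Rightarrow> nat) \<Rightarrow> 'n \<Rightarrow> ('s \<Rightarrow> 'o set) \<Rightarrow> bool" where
  "ocpn_enabled N M t b \<longleftrightarrow> (\<forall>q. of_bool (q \<in> cons_tokens N t b) \<le> M q)"

text \<open>
  Markings are \<open>{0, 1}\<close>-valued, so the sum in \<open>M - cons + prod\<close> is the one of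
  \<open>{0, 1}\<close>-valued functions (union of token sets): it is capped at 1, and firing always yields
  a marking.
\<close>

definition ocpn_fire ::
    "('n, 's, 'a) ocpn \<Rightarrow> ('n \<times> 'o \<Rightarrow> nat) \<Rightarrow> 'n \<Rightarrow> ('s \<Rightarrow> 'o set) \<Rightarrow> ('n \<times> 'o \<Rightarrow> nat)" where
  "ocpn_fire N M t b =
     (\<lambda>q. min 1 (M q - of_bool (q \<in> cons_tokens N t b) + of_bool (q \<in> prod_tokens N t b)))"

definition ocpn_step ::
    "('o \<Rightarrow> 's) \<Rightarrow> ('n, 's, 'a) ocpn \<Rightarrow> ('n \<times> 'o \<Rightarrow> nat) \<Rightarrow> 'n \<Rightarrow> ('s \<Rightarrow> 'o set) \<Rightarrow>
     ('n \<times> 'o \<Rightarrow> nat) \<Rightarrow> bool" where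
  "ocpn_step ot N M t b M' \<longleftrightarrow>
     ocpn_marking ot N M \<and> binding_execution ot N t b \<and> ocpn_enabled N M t b \<and>
     M' = ocpn_fire N M t b"

definition M_init :: "('o \<Rightarrow> 's) \<Rightarrow> ('n, 's, 'a) ocpn \<Rightarrow> 'o set \<Rightarrow> 'n \<times> 'o \<Rightarrow> nat" where
  "M_init ot N Obs = (\<lambda>(p, obj). of_bool (obj \<in> Obs \<and> p = play_place N (ot obj)))"

definition M_final :: "('o \<Rightarrow> 's) \<Rightarrow> ('n, 's, 'a) ocpn \<Rightarrow> 'o set \<Rightarrow> 'n \<times> 'o \<Rightarrow> nat" where
  "M_final ot N Obs = (\<lambda>(p, obj). of_bool (obj \<in> Obs \<and> p = stop_place N (ot obj)))"


section \<open>Object-centric Petri nets with identifiers\<close>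

text \<open>
  \<open>vty\<close> gives the type of object and fresh variables; for a list variable, whose type is
  the list type over \<open>\<sigma>\<close>, it gives \<open>\<sigma>\<close>.
\<close>

record ('v, 's) variables =
  obj_vars :: "'v set"
  list_vars :: "'v set"
  fresh_vars :: "'v set"
  vty :: "'v \<Rightarrow> 's"

definition wf_variables :: "('v, 's) variables \<Rightarrow> bool" where
  "wf_variables V \<longleftrightarrow>
     obj_vars V \<inter> list_vars V = {} \<and> obj_vars V \<inter> fresh_vars V = {} \<and>
     list_vars V \<inter> fresh_vars V = {}"

definition inscription :: "('v, 's) variables \<Rightarrow> 'v list \<Rightarrow> bool" where
  "inscription V \<iota> \<longleftrightarrow>
     set \<iota> \<subseteq> obj_vars V \<union> list_vars V \<union> fresh_vars V \<and>
     length (filter (\<lambda>y. y \<in> list_vars V) \<iota>) \<le> 1"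

record ('p, 't, 'v, 's, 'a) opid =
  places :: "'p set"
  transitions :: "'t set"
  F_in :: "'p \<Rightarrow> 't \<Rightarrow> 'v list option"
  F_out :: "'t \<Rightarrow> 'p \<Rightarrow> 'v list option"
  color :: "'p \<Rightarrow> 's list"
  tlabel :: "'t \<Rightarrow> 'a option"

definition vars_in :: "('p, 't, 'v, 's, 'a) opid \<Rightarrow> 't \<Rightarrow> 'v set" where
  "vars_in N t = \<Union> {set \<iota> | \<iota> p. F_in N p t = Some \<iota>}"

definition vars_out :: "('p, 't, 'v, 's, 'a) opid \<Rightarrow> 't \<Rightarrow> 'v set" where
  "vars_out N t = \<Union> {set \<iota> | \<iota> p. F_out N t p = Some \<iota>}"

definition wf_opid :: "('v, 's) variables \<Rightarrow> ('p, 't, 'v, 's, 'a) opid \<Rightarrow> bool" where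
  "wf_opid V N \<longleftrightarrow>
     (\<forall>p t \<iota>. F_in N p t = Some \<iota> \<longrightarrow>
        p \<in> places N \<and> t \<in> transitions N \<and> inscription V \<iota> \<and> map (vty V) \<iota> = color N p) \<and>
     (\<forall>t p \<iota>. F_out N t p = Some \<iota> \<longrightarrow>
        p \<in> places N \<and> t \<in> transitions N \<and> inscription V \<iota> \<and> map (vty V) \<iota> = color N p) \<and>
     (\<forall>t. vars_in N t \<inter> fresh_vars V = {}) \<and>
     (\<forall>t. vars_out N t \<subseteq> vars_in N t \<union> fresh_vars V)"

definition opid_marking ::
    "('o \<Rightarrow> 's) \<Rightarrow> ('p, 't, 'v, 's, 'a) opid \<Rightarrow> ('p \<Rightarrow> 'o list set) \<Rightarrow> bool" where
  "opid_marking ot N M \<longleftrightarrow>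
     (\<forall>p\<in>places N. \<forall>w\<in>M p. map ot w = color N p) \<and> (\<forall>p. p \<notin> places N \<longrightarrow> M p = {})"

definition empty_marking :: "'p \<Rightarrow> 'o list set" where
  "empty_marking = (\<lambda>p. {})"

definition marking_objects :: "('p \<Rightarrow> 'o list set) \<Rightarrow> 'o set" where
  "marking_objects M = (\<Union>p. \<Union>w\<in>M p. set w)"

datatype 'o val = Obj (the_obj: 'o) | Lst (the_list: "'o list")

fun val_objects :: "'o val \<Rightarrow> 'o set" where
  "val_objects (Obj u) = {u}"
| "val_objects (Lst us) = set us"

fun has_type :: "('o \<Rightarrow> 's) \<Rightarrow> ('v, 's) variables \<Rightarrow> 'v \<Rightarrow> 'o val \<Rightarrow> bool" where
  "has_type ot V y (Obj u) \<longleftrightarrow> y \<in> obj_vars V \<union> fresh_vars V \<and> ot u = vty V y"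
| "has_type ot V y (Lst us) \<longleftrightarrow> y \<in> list_vars V \<and> (\<forall>u\<in>set us. ot u = vty V y)"

definition opid_binding ::
    "('o \<Rightarrow> 's) \<Rightarrow> ('v, 's) variables \<Rightarrow> ('p, 't, 'v, 's, 'a) opid \<Rightarrow> ('p \<Rightarrow> 'o list set) \<Rightarrow>
     't \<Rightarrow> ('v \<rightharpoonup> 'o val) \<Rightarrow> bool" where
  "opid_binding ot V N M t \<beta> \<longleftrightarrow>
     dom \<beta> = vars_in N t \<union> vars_out N t \<and>
     (\<forall>y a. \<beta> y = Some a \<longrightarrow> has_type ot V y a) \<and>
     inj_on \<beta> (dom \<beta> \<inter> fresh_vars V) \<and>
     (\<forall>y\<in>fresh_vars V. \<forall>u. \<beta> y = Some (Obj u) \<longrightarrow> u \<notin> marking_objects M)"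

definition inst :: "('v, 's) variables \<Rightarrow> ('v \<rightharpoonup> 'o val) \<Rightarrow> 'v list \<Rightarrow> 'o list set" where
  "inst V \<beta> \<iota> =
     (case filter (\<lambda>y. y \<in> list_vars V) \<iota> of
        [] \<Rightarrow> {map (\<lambda>y. the_obj (the (\<beta> y))) \<iota>}
      | z # _ \<Rightarrow> {map (\<lambda>y. if y = z then u else the_obj (the (\<beta> y))) \<iota> | u.
                   u \<in> set (the_list (the (\<beta> z)))})"

definition inst_arc ::
    "('v, 's) variables \<Rightarrow> ('v \<rightharpoonup> 'o val) \<Rightarrow> 'v list option \<Rightarrow> 'o list set" where
  "inst_arc V \<beta> a = (case a of None \<Rightarrow> {} | Some \<iota> \<Rightarrow> inst V \<beta> \<iota>)"

text \<open>A step with a binding over the set of objects \<open>Obs\<close>.\<close>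

definition opid_step ::
    "('o \<Rightarrow> 's) \<Rightarrow> ('v, 's) variables \<Rightarrow> ('p, 't, 'v, 's, 'a) opid \<Rightarrow> 'o set \<Rightarrow>
     ('p \<Rightarrow> 'o list set) \<Rightarrow> 't \<Rightarrow> ('v \<rightharpoonup> 'o val) \<Rightarrow> ('p \<Rightarrow> 'o list set) \<Rightarrow> bool" where
  "opid_step ot V N Obs M t \<beta> M' \<longleftrightarrow>
     t \<in> transitions N \<and> opid_marking ot N M \<and> opid_binding ot V N M t \<beta> \<and>
     (\<forall>a\<in>ran \<beta>. val_objects a \<subseteq> Obs) \<and>
     (\<forall>p. inst_arc V \<beta> (F_in N p t) \<subseteq> M p) \<and>
     M' = (\<lambda>p. (M p - inst_arc V \<beta> (F_in N p t)) \<union> inst_arc V \<beta> (F_out N t p))"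

definition opid_steps ::
    "('o \<Rightarrow> 's) \<Rightarrow> ('v, 's) variables \<Rightarrow> ('p, 't, 'v, 's, 'a) opid \<Rightarrow> 'o set \<Rightarrow> 't set \<Rightarrow>
     ('p \<Rightarrow> 'o list set) \<Rightarrow> ('p \<Rightarrow> 'o list set) \<Rightarrow> bool" where
  "opid_steps ot V N Obs S = (\<lambda>M M'. \<exists>t\<in>S. \<exists>\<beta>. opid_step ot V N Obs M t \<beta> M')\<^sup>*\<^sup>*"


section \<open>The mapping\<close>

datatype ('n, 's) t1_trans = Orig 'n | Emit 's | Consume 's

text \<open>
  The parameters \<open>xv\<close>, \<open>lv\<close>, \<open>fv\<close> select, for each type, an object variable, a list
  variable and a fresh-object variable of that type.
\<close>

definition variable_choice ::
    "('v, 's) variables \<Rightarrow> ('s \<Rightarrow> 'v) \<Rightarrow> ('s \<Rightarrow> 'v) \<Rightarrow> ('s \<Rightarrow> 'v) \<Rightarrow> bool" where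
  "variable_choice V xv lv fv \<longleftrightarrow>
     (\<forall>\<sigma>. xv \<sigma> \<in> obj_vars V \<and> vty V (xv \<sigma>) = \<sigma>) \<and>
     (\<forall>\<sigma>. lv \<sigma> \<in> list_vars V \<and> vty V (lv \<sigma>) = \<sigma>) \<and>
     (\<forall>\<sigma>. fv \<sigma> \<in> fresh_vars V \<and> vty V (fv \<sigma>) = \<sigma>)"

fun T1_in :: "('s \<Rightarrow> 'v) \<Rightarrow> ('s \<Rightarrow> 'v) \<Rightarrow> ('n, 's, 'a) ocpn \<Rightarrow> 'n \<Rightarrow> ('n, 's) t1_trans \<Rightarrow>
    'v list option" where
  "T1_in xv lv N p (Orig t) =
     (if p \<in> plc N \<and> t \<in> trn N \<and> (p, t) \<in> flow N
      then Some [if (p, t) \<in> vflow N then lv (ptype N p) else xv (ptype N p)] else None)"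
| "T1_in xv lv N p (Emit \<sigma>) = None"
| "T1_in xv lv N p (Consume \<sigma>) = (if p = stop_place N \<sigma> then Some [xv \<sigma>] else None)"

fun T1_out :: "('s \<Rightarrow> 'v) \<Rightarrow> ('s \<Rightarrow> 'v) \<Rightarrow> ('s \<Rightarrow> 'v) \<Rightarrow> ('n, 's, 'a) ocpn \<Rightarrow> ('n, 's) t1_trans \<Rightarrow>
    'n \<Rightarrow> 'v list option" where
  "T1_out xv lv fv N (Orig t) p =
     (if p \<in> plc N \<and> t \<in> trn N \<and> (t, p) \<in> flow N
      then Some [if (t, p) \<in> vflow N then lv (ptype N p) else xv (ptype N p)] else None)"
| "T1_out xv lv fv N (Emit \<sigma>) p = (if p = play_place N \<sigma> then Some [fv \<sigma>] else None)"
| "T1_out xv lv fv N (Consume \<sigma>) p = None"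

definition T1 :: "('s \<Rightarrow> 'v) \<Rightarrow> ('s \<Rightarrow> 'v) \<Rightarrow> ('s \<Rightarrow> 'v) \<Rightarrow> ('n, 's, 'a) ocpn \<Rightarrow>
    ('n, ('n, 's) t1_trans, 'v, 's, 'a) opid" where
  "T1 xv lv fv N =
     \<lparr> places = plc N,
       transitions = Orig ` trn N \<union> range Emit \<union> range Consume,
       F_in = T1_in xv lv N,
       F_out = T1_out xv lv fv N,
       color = (\<lambda>p. [ptype N p]),
       tlabel = (\<lambda>t. case t of Orig t' \<Rightarrow> lab N t' | Emit _ \<Rightarrow> None | Consume _ \<Rightarrow> None) \<rparr>"

text \<open>
  For an accepting net \<open>N\<close>, all conditions of \<open>wf_opid\<close> hold for \<open>T1 xv lv fv N\<close> automatically
  except the last one, which holds iff \<open>ptype N ` post N t \<subseteq> ptype N ` pre N t\<close> for every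
  transition \<open>t\<close>: a variable on an output arc of \<open>Orig t\<close> must occur on one of its input arcs.
\<close>

definition T1_marking :: "('n \<times> 'o \<Rightarrow> nat) \<Rightarrow> 'n \<Rightarrow> 'o list set" where
  "T1_marking M = (\<lambda>p. {[obj] | obj. M (p, obj) > 0})"

text \<open>
  A relation, since the order of the lists is arbitrary. A binding is defined exactly on the
  variables on the arcs of \<open>t\<close>, so a type in \<open>tpl_var N t\<close> always uses its list variable, also
  when the set bound to it happens to be a singleton.
\<close>

definition T1_binding ::
    "('s \<Rightarrow> 'v) \<Rightarrow> ('s \<Rightarrow> 'v) \<Rightarrow> ('n, 's, 'a) ocpn \<Rightarrow> 'n \<Rightarrow> ('s \<Rightarrow> 'o set) \<Rightarrow>
     ('v \<rightharpoonup> 'o val) \<Rightarrow> bool" where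
  "T1_binding xv lv N t b \<beta> \<longleftrightarrow>
     dom \<beta> = xv ` tpl_nv N t \<union> lv ` tpl_var N t \<and>
     (\<forall>\<sigma>\<in>tpl_nv N t. \<beta> (xv \<sigma>) = Some (Obj (the_elem (b \<sigma>)))) \<and>
     (\<forall>\<sigma>\<in>tpl_var N t. \<exists>us. distinct us \<and> set us = b \<sigma> \<and> \<beta> (lv \<sigma>) = Some (Lst us))"

end

theory Submission
  imports Defs
begin

text \<open>
  An original transition of \<open>T1 N\<close> consumes and produces exactly the images of the tokens consumed
  and produced by the OCPN binding, so single steps correspond to each other. The only additional
  requirement on the OPID side is that the bindings take values in \<open>Obs\<close>. Well-formedness of
  \<open>T1 N\<close> forces every type of a transition to occur on an input arc, hence every bound object is
  present in the current marking, and no step introduces objects outside \<open>Obs\<close>. The initial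
  marking is emitted, and the final marking consumed, one object at a time.
\<close>

section \<open>Membership characterisations and the passage between the two kinds of marking\<close>

lemma in_vars_in_iff:
  "y \<in> vars_in N t \<longleftrightarrow> (\<exists>p \<iota>. F_in N p t = Some \<iota> \<and> y \<in> set \<iota>)"
  by (auto simp: vars_in_def)

lemma in_vars_out_iff:
  "y \<in> vars_out N t \<longleftrightarrow> (\<exists>p \<iota>. F_out N t p = Some \<iota> \<and> y \<in> set \<iota>)"
  by (auto simp: vars_out_def)

lemma ocpn_enabled_iff:
  "ocpn_enabled N M t b \<longleftrightarrow> (\<forall>p u. (p, u) \<in> cons_tokens N t b \<longrightarrow> M (p, u) > 0)"
  by (simp add: ocpn_enabled_def of_bool_def Suc_le_eq)

lemma in_inst_singleton:
  "w \<in> inst V \<beta> [y] \<longleftrightarrow>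
     (if y \<in> list_vars V then \<exists>u\<in>set (the_list (the (\<beta> y))). w = [u]
      else w = [the_obj (the (\<beta> y))])"
  by (auto simp: inst_def)

lemma singleton_in_T1_marking [simp]: "[u] \<in> T1_marking M p \<longleftrightarrow> M (p, u) > 0"
  by (auto simp: T1_marking_def)

lemma ocpn_marking_le_1: "ocpn_marking ot N M \<Longrightarrow> M q \<le> 1"
  unfolding ocpn_marking_def by (metis insertE le_refl singletonD zero_le_one)

text \<open>\<open>T1_marking\<close> records only which counts are positive, so it is injective
  exactly because the counts are bounded by 1. This lets an equation between OPID markings be read
  back as one between OCPN markings.\<close>

lemma T1_marking_eq_iff:
  fixes M M' :: "'n \<times> 'o \<Rightarrow> nat"
  assumes "ocpn_marking ot N M" "ocpn_marking ot N M'"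
  shows "T1_marking M = T1_marking M' \<longleftrightarrow> M = M'"
proof
  assume eq: "T1_marking M = T1_marking M'"
  show "M = M'"
  proof
    fix q :: "'n \<times> 'o"
    obtain p u where q: "q = (p, u)" by fastforce
    have "M q > 0 \<longleftrightarrow> M' q > 0"
      using eq singleton_in_T1_marking unfolding q by metis
    moreover have "M q \<le> 1" "M' q \<le> 1"
      using assms by (blast intro: ocpn_marking_le_1)+
    ultimately show "M q = M' q" by linarith
  qed
qed simp

section \<open>The chosen variables, the play and stop places, and the typing of translated
  markings\<close>

locale T1_translation =
  fixes ot :: "'o \<Rightarrow> 's"
    and N :: "('n, 's, 'a) ocpn"
    and V :: "('v, 's) variables"
    and xv lv fv :: "'s \<Rightarrow> 'v"
  assumes accepting: "accepting_ocpn N"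
    and wf_vars: "wf_variables V"
    and choice: "variable_choice V xv lv fv"
begin

abbreviation "N' \<equiv> T1 xv lv fv N"

lemma wf: "wf_ocpn N"
  using accepting by (simp add: accepting_ocpn_def)

lemma vty_simps [simp]: "vty V (xv \<sigma>) = \<sigma>" "vty V (lv \<sigma>) = \<sigma>" "vty V (fv \<sigma>) = \<sigma>"
  using choice by (auto simp: variable_choice_def)

lemma var_kinds [simp]:
  "xv \<sigma> \<in> obj_vars V" "xv \<sigma> \<notin> list_vars V" "xv \<sigma> \<notin> fresh_vars V"
  "lv \<sigma> \<notin> obj_vars V" "lv \<sigma> \<in> list_vars V" "lv \<sigma> \<notin> fresh_vars V"
  "fv \<sigma> \<notin> obj_vars V" "fv \<sigma> \<notin> list_vars V" "fv \<sigma> \<in> fresh_vars V"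
  using choice wf_vars unfolding variable_choice_def wf_variables_def by blast+

text \<open>\<open>vty\<close> is a left inverse of \<open>xv\<close> and of \<open>lv\<close>, and
  the variable kinds are disjoint. Hence a variable on an arc of an original transition determines
  both its kind and its type.\<close>

lemma var_eq_simps [simp]:
  "xv \<sigma> = xv \<rho> \<longleftrightarrow> \<sigma> = \<rho>" "lv \<sigma> = lv \<rho> \<longleftrightarrow> \<sigma> = \<rho>" "xv \<sigma> \<noteq> lv \<rho>" "lv \<sigma> \<noteq> xv \<rho>"
  using vty_simps var_kinds by metis+

lemma play_place: "play_place N \<sigma> \<in> plc N" "ptype N (play_place N \<sigma>) = \<sigma>"
proof -
  have "\<exists>!p. p \<in> play N \<and> ptype N p = \<sigma>" "play N \<subseteq> plc N"
    using accepting by (auto simp: accepting_ocpn_def)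
  from theI'[OF this(1)] this(2)
  show "play_place N \<sigma> \<in> plc N" "ptype N (play_place N \<sigma>) = \<sigma>"
    by (auto simp: play_place_def)
qed

lemma stop_place: "stop_place N \<sigma> \<in> plc N" "ptype N (stop_place N \<sigma>) = \<sigma>"
proof -
  have "\<exists>!p. p \<in> stop N \<and> ptype N p = \<sigma>" "stop N \<subseteq> plc N"
    using accepting by (auto simp: accepting_ocpn_def)
  from theI'[OF this(1)] this(2)
  show "stop_place N \<sigma> \<in> plc N" "ptype N (stop_place N \<sigma>) = \<sigma>"
    by (auto simp: stop_place_def)
qed

lemma ocpn_marking_M_init: "ocpn_marking ot N (M_init ot N A)"
  by (auto simp: ocpn_marking_def M_init_def token_set_def play_place)

lemma ocpn_marking_M_final: "ocpn_marking ot N (M_final ot N A)"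
  by (auto simp: ocpn_marking_def M_final_def token_set_def stop_place)

lemma opid_marking_T1_marking:
  assumes "ocpn_marking ot N M"
  shows "opid_marking ot N' (T1_marking M)"
proof -
  have "(p, u) \<in> token_set ot N" if "M (p, u) > 0" for p u
    using assms that unfolding ocpn_marking_def by (metis less_irrefl)
  then show ?thesis
    by (fastforce simp: opid_marking_def T1_def T1_marking_def token_set_def)
qed

section \<open>Arcs and variables of the original transitions\<close>

lemma flow_places:
  assumes "t \<in> trn N"
  shows "(p, t) \<in> flow N \<Longrightarrow> p \<in> plc N" "(t, p) \<in> flow N \<Longrightarrow> p \<in> plc N"
  using assms wf by (auto simp: wf_ocpn_def)

lemma vflow_flow: "e \<in> vflow N \<Longrightarrow> e \<in> flow N"
  using wf by (auto simp: wf_ocpn_def)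

lemma arc_var:
  assumes "t \<in> trn N"
  shows "F_in N' p (Orig t) =
      (if p \<in> pre N t then Some [if (p, t) \<in> vflow N then lv (ptype N p) else xv (ptype N p)]
       else None)"
    and "F_out N' (Orig t) p =
      (if p \<in> post N t then Some [if (t, p) \<in> vflow N then lv (ptype N p) else xv (ptype N p)]
       else None)"
  using assms flow_places[of t p] by (auto simp: T1_def pre_def post_def)

lemma tpl_eq: "tpl N t = tpl_nv N t \<union> tpl_var N t"
  using vflow_flow by (auto simp: tpl_def tpl_nv_def tpl_var_def pre_def post_def)

lemma Orig_vars:
  assumes "t \<in> trn N"
  shows "vars_in N' (Orig t) =
      (\<lambda>p. if (p, t) \<in> vflow N then lv (ptype N p) else xv (ptype N p)) ` pre N t"
    and "vars_out N' (Orig t) =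
      (\<lambda>p. if (t, p) \<in> vflow N then lv (ptype N p) else xv (ptype N p)) ` post N t"
  by (auto simp: in_vars_in_iff in_vars_out_iff arc_var[OF assms] set_eq_iff image_iff)

text \<open>This identifies the domain prescribed by \<open>T1_binding\<close> with the one that
  \<open>opid_binding\<close> demands.\<close>

lemma Orig_vars_un:
  assumes "t \<in> trn N"
  shows "vars_in N' (Orig t) \<union> vars_out N' (Orig t) = xv ` tpl_nv N t \<union> lv ` tpl_var N t"
proof -
  \<comment> \<open>Splitting each neighbourhood by arc kind turns the conditional images into
    unions of the shape found in \<open>tpl_nv\<close> and \<open>tpl_var\<close>.\<close>
  have "pre N t = {p. (p, t) \<in> flow N - vflow N} \<union> {p. (p, t) \<in> vflow N}"
    "post N t = {p. (t, p) \<in> flow N - vflow N} \<union> {p. (t, p) \<in> vflow N}"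
    using vflow_flow by (auto simp: pre_def post_def)
  then show ?thesis
    unfolding Orig_vars[OF assms] tpl_nv_def tpl_var_def by (auto 0 3)
qed

text \<open>The consequence of \<open>wf_opid\<close> that drives the forward direction: the
  variable on an output arc has to reappear on an input arc, and it carries its type with
  it.\<close>

lemma tpl_input:
  assumes "wf_opid V N'" "t \<in> trn N" "\<sigma> \<in> tpl N t"
  shows "\<exists>p\<in>pre N t. ptype N p = \<sigma>"
proof -
  from assms(3) consider "\<exists>p\<in>pre N t. ptype N p = \<sigma>" | p where "p \<in> post N t" "ptype N p = \<sigma>"
    by (auto simp: tpl_def)
  then show ?thesis
  proof cases
    case 2
    let ?y = "if (t, p) \<in> vflow N then lv \<sigma> else xv \<sigma>"
    have "?y \<in> vars_out N' (Orig t)"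
      unfolding Orig_vars[OF assms(2)] using 2 by (auto intro!: rev_image_eqI)
    \<comment> \<open>This excludes the other source that \<open>wf_opid\<close> allows for an
      output variable.\<close>
    moreover have "?y \<notin> fresh_vars V" by simp
    ultimately have "?y \<in> vars_in N' (Orig t)"
      using assms(1) unfolding wf_opid_def by blast
    then obtain p' where "p' \<in> pre N t"
      "?y = (if (p', t) \<in> vflow N then lv (ptype N p') else xv (ptype N p'))"
      unfolding Orig_vars[OF assms(2)] by blast
    then show ?thesis by (auto split: if_splits)
  qed
qed

section \<open>Translated bindings and the tokens they move\<close>

text \<open>For a non-variable type the bound set is a singleton, so \<open>the_elem\<close> loses
  nothing; for a variable type the list enumerates the bound set. Both arc kinds therefore carry the
  same tokens.\<close>

lemma T1_binding_inst:
  assumes "binding_execution ot N t b" "T1_binding xv lv N t b \<beta>"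
  shows "\<sigma> \<in> tpl_nv N t \<Longrightarrow> w \<in> inst V \<beta> [xv \<sigma>] \<longleftrightarrow> (\<exists>u\<in>b \<sigma>. w = [u])"
    and "\<sigma> \<in> tpl_var N t \<Longrightarrow> w \<in> inst V \<beta> [lv \<sigma>] \<longleftrightarrow> (\<exists>u\<in>b \<sigma>. w = [u])"
proof -
  assume \<sigma>: "\<sigma> \<in> tpl_nv N t"
  then have "card (b \<sigma>) = 1" using assms(1) by (simp add: binding_execution_def)
  then obtain u where "b \<sigma> = {u}" by (auto simp: card_1_singleton_iff)
  moreover have "\<beta> (xv \<sigma>) = Some (Obj (the_elem (b \<sigma>)))"
    using assms(2) \<sigma> by (simp add: T1_binding_def)
  ultimately show "w \<in> inst V \<beta> [xv \<sigma>] \<longleftrightarrow> (\<exists>u\<in>b \<sigma>. w = [u])"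
    by (simp add: in_inst_singleton)
next
  assume "\<sigma> \<in> tpl_var N t"
  then obtain us where "set us = b \<sigma>" "\<beta> (lv \<sigma>) = Some (Lst us)"
    using assms(2) by (auto simp: T1_binding_def)
  then show "w \<in> inst V \<beta> [lv \<sigma>] \<longleftrightarrow> (\<exists>u\<in>b \<sigma>. w = [u])"
    by (simp add: in_inst_singleton)
qed

lemma inst_arc_Orig:
  assumes "binding_execution ot N t b" "T1_binding xv lv N t b \<beta>"
  shows "inst_arc V \<beta> (F_in N' p (Orig t)) = {[u] | u. (p, u) \<in> cons_tokens N t b}"
    and "inst_arc V \<beta> (F_out N' (Orig t) p) = {[u] | u. (p, u) \<in> prod_tokens N t b}"
proof -
  have t: "t \<in> trn N" using assms(1) by (simp add: binding_execution_def)
  \<comment> \<open>The flag \<open>v\<close> stands for an arc being variable, so that one fact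
    serves input and output arcs.\<close>
  have arc: "inst V \<beta> [if v then lv \<sigma> else xv \<sigma>] = {[u] | u. u \<in> b \<sigma>}"
    if "if v then \<sigma> \<in> tpl_var N t else \<sigma> \<in> tpl_nv N t" for v \<sigma>
    using that by (cases v) (auto simp: T1_binding_inst[OF assms])
  show "inst_arc V \<beta> (F_in N' p (Orig t)) = {[u] | u. (p, u) \<in> cons_tokens N t b}"
  proof (cases "p \<in> pre N t")
    case True
    then have "if (p, t) \<in> vflow N then ptype N p \<in> tpl_var N t else ptype N p \<in> tpl_nv N t"
      by (auto simp: tpl_var_def tpl_nv_def pre_def)
    from arc[OF this] True show ?thesis
      by (simp add: inst_arc_def arc_var[OF t] cons_tokens_def)
  qed (simp add: inst_arc_def arc_var[OF t] cons_tokens_def)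
  show "inst_arc V \<beta> (F_out N' (Orig t) p) = {[u] | u. (p, u) \<in> prod_tokens N t b}"
  proof (cases "p \<in> post N t")
    case True
    then have "if (t, p) \<in> vflow N then ptype N p \<in> tpl_var N t else ptype N p \<in> tpl_nv N t"
      by (auto simp: tpl_var_def tpl_nv_def post_def)
    from arc[OF this] True show ?thesis
      by (simp add: inst_arc_def arc_var[OF t] prod_tokens_def)
  qed (simp add: inst_arc_def arc_var[OF t] prod_tokens_def)
qed

text \<open>Collects what is needed of a single value: its typing and non-fresh variable for
  \<open>opid_binding\<close>, and its objects for the restriction to \<open>Obs\<close>.\<close>

lemma T1_binding_value:
  assumes "binding_execution ot N t b" "T1_binding xv lv N t b \<beta>" "\<beta> y = Some a"
  obtains \<sigma> where "\<sigma> \<in> tpl N t" "val_objects a = b \<sigma>" "has_type ot V y a" "y \<notin> fresh_vars V"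
proof -
  have "y \<in> xv ` tpl_nv N t \<union> lv ` tpl_var N t"
    using assms(2,3) unfolding T1_binding_def by blast
  then consider \<sigma> where "\<sigma> \<in> tpl_nv N t" "y = xv \<sigma>" | \<sigma> where "\<sigma> \<in> tpl_var N t" "y = lv \<sigma>"
    by blast
  then show thesis
  proof cases
    case 1
    then have tpl: "\<sigma> \<in> tpl N t" by (simp add: tpl_eq)
    have "card (b \<sigma>) = 1" using assms(1) 1 by (simp add: binding_execution_def)
    then obtain u where u: "b \<sigma> = {u}" by (auto simp: card_1_singleton_iff)
    then have "a = Obj u" using assms(2,3) 1 by (simp add: T1_binding_def)
    moreover have "ot u = \<sigma>" using assms(1) tpl u by (auto simp: binding_execution_def)
    ultimately show thesis using that[OF tpl] 1 u by simp
  next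
    case 2
    then have tpl: "\<sigma> \<in> tpl N t" by (simp add: tpl_eq)
    obtain us where us: "set us = b \<sigma>" "\<beta> (lv \<sigma>) = Some (Lst us)"
      using assms(2) 2 by (auto simp: T1_binding_def)
    then have "a = Lst us" using assms(3) 2 by simp
    moreover have "\<forall>u\<in>b \<sigma>. ot u = \<sigma>" using assms(1) tpl by (auto simp: binding_execution_def)
    ultimately show thesis using that[OF tpl] 2 us by simp
  qed
qed

text \<open>No fresh variable lies in the domain, so the injectivity and freshness conditions hold
  vacuously, for every marking \<open>M\<close>.\<close>

lemma opid_binding_T1_binding:
  assumes "binding_execution ot N t b" "T1_binding xv lv N t b \<beta>"
  shows "opid_binding ot V N' M (Orig t) \<beta>"
proof -
  note val = T1_binding_value[OF assms]
  have "t \<in> trn N" using assms(1) by (simp add: binding_execution_def)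
  then have "dom \<beta> = vars_in N' (Orig t) \<union> vars_out N' (Orig t)"
    using assms(2) by (simp only: T1_binding_def Orig_vars_un)
  moreover have "dom \<beta> \<inter> fresh_vars V = {}" using val by blast
  moreover have "\<forall>y a. \<beta> y = Some a \<longrightarrow> has_type ot V y a" using val by blast
  ultimately show ?thesis by (auto simp: opid_binding_def)
qed

section \<open>Firing and the correspondence of single steps\<close>

lemma ocpn_marking_fire:
  assumes "ocpn_marking ot N M" "binding_execution ot N t b"
  shows "ocpn_marking ot N (ocpn_fire N M t b)"
proof -
  have "q \<in> token_set ot N" if "q \<in> prod_tokens N t b" for q
    using that assms(2) flow_places[of t]
    by (fastforce simp: prod_tokens_def token_set_def binding_execution_def tpl_def post_def)
  then show ?thesis
    using assms(1) by (auto simp: ocpn_marking_def ocpn_fire_def)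
qed

lemma T1_marking_fire:
  assumes "ocpn_marking ot N M"
  shows "T1_marking (ocpn_fire N M t b) p =
    (T1_marking M p - {[u] | u. (p, u) \<in> cons_tokens N t b}) \<union>
      {[u] | u. (p, u) \<in> prod_tokens N t b}"
proof -
  have "0 < ocpn_fire N M t b (p, u) \<longleftrightarrow>
      M (p, u) > 0 \<and> (p, u) \<notin> cons_tokens N t b \<or> (p, u) \<in> prod_tokens N t b" for u
    \<comment> \<open>The bound 1 ensures that consuming a token leaves count 0; a larger count
      would survive the subtraction.\<close>
    using ocpn_marking_le_1[OF assms, of "(p, u)"] by (auto simp: ocpn_fire_def)
  then show ?thesis by (auto simp: T1_marking_def)
qed

text \<open>Enabledness and the marking update match separately, the latter in both directions by
  injectivity of \<open>T1_marking\<close>. Only the restriction of values to \<open>Obs\<close> has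
  no OCPN counterpart.\<close>

lemma opid_step_Orig_iff:
  assumes "ocpn_marking ot N M" "ocpn_marking ot N M'" "binding_execution ot N t b"
    and "T1_binding xv lv N t b \<beta>"
  shows "opid_step ot V N' Obs (T1_marking M) (Orig t) \<beta> (T1_marking M') \<longleftrightarrow>
    ocpn_step ot N M t b M' \<and> (\<forall>a\<in>ran \<beta>. val_objects a \<subseteq> Obs)"
proof -
  have "Orig t \<in> transitions N'"
    using assms(3) by (simp add: T1_def binding_execution_def)
  moreover have "(\<forall>p. inst_arc V \<beta> (F_in N' p (Orig t)) \<subseteq> T1_marking M p) \<longleftrightarrow>
      ocpn_enabled N M t b"
    unfolding inst_arc_Orig[OF assms(3,4)]
    by (simp add: ocpn_enabled_iff T1_marking_def subset_iff) blast
  moreover have "T1_marking M' = (\<lambda>p. (T1_marking M p - inst_arc V \<beta> (F_in N' p (Orig t))) \<union>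
      inst_arc V \<beta> (F_out N' (Orig t) p)) \<longleftrightarrow> M' = ocpn_fire N M t b"
    unfolding inst_arc_Orig[OF assms(3,4)] T1_marking_fire[OF assms(1), symmetric]
    by (rule T1_marking_eq_iff[OF assms(2) ocpn_marking_fire[OF assms(1,3)]])
  ultimately show ?thesis
    unfolding opid_step_def ocpn_step_def
    using assms opid_marking_T1_marking opid_binding_T1_binding by blast
qed

section \<open>Objects along a run, and existence of translated bindings\<close>

text \<open>By \<open>tpl_input\<close> each bound object is demanded at some input place, where
  enabledness provides its token.\<close>

lemma enabled_bound_objects:
  assumes "wf_opid V N'" "ocpn_step ot N M t b M'" "\<sigma> \<in> tpl N t"
  shows "b \<sigma> \<subseteq> {u. \<exists>p. M (p, u) > 0}"
proof
  fix u assume u: "u \<in> b \<sigma>"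
  have "t \<in> trn N" using assms(2) by (simp add: ocpn_step_def binding_execution_def)
  then obtain p where "p \<in> pre N t" "ptype N p = \<sigma>"
    using tpl_input assms(1,3) by blast
  then have "(p, u) \<in> cons_tokens N t b" using u by (simp add: cons_tokens_def)
  then show "u \<in> {u. \<exists>p. M (p, u) > 0}"
    using assms(2) by (auto simp: ocpn_step_def ocpn_enabled_iff)
qed

text \<open>Produced tokens carry bound objects, which were already present before the step.\<close>

lemma ocpn_step_objects:
  assumes "wf_opid V N'" "ocpn_step ot N M t b M'"
  shows "{u. \<exists>p. M' (p, u) > 0} \<subseteq> {u. \<exists>p. M (p, u) > 0}"
proof clarify
  fix u p assume "M' (p, u) > 0"
  then consider "M (p, u) > 0" | "(p, u) \<in> prod_tokens N t b"
    using assms(2) by (auto simp: ocpn_step_def ocpn_fire_def split: if_splits)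
  then show "\<exists>p. M (p, u) > 0"
  proof cases
    case 2
    then have "ptype N p \<in> tpl N t" "u \<in> b (ptype N p)"
      by (auto simp: prod_tokens_def tpl_def)
    then show ?thesis using enabled_bound_objects[OF assms] by blast
  qed blast
qed

lemma T1_binding_exists:
  assumes "\<And>\<sigma>. \<sigma> \<in> tpl N t \<Longrightarrow> finite (b \<sigma>)"
  shows "\<exists>\<beta>. T1_binding xv lv N t b \<beta>"
proof -
  have "\<forall>\<sigma>\<in>tpl_var N t. \<exists>us. distinct us \<and> set us = b \<sigma>"
    using assms finite_distinct_list tpl_eq by (metis UnCI)
  then obtain us where us: "\<And>\<sigma>. \<sigma> \<in> tpl_var N t \<Longrightarrow> distinct (us \<sigma>) \<and> set (us \<sigma>) = b \<sigma>"
    by metis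
  \<comment> \<open>The type is recovered from the variable by \<open>vty\<close>. The order of the
    two tests is harmless because \<open>xv\<close> and \<open>lv\<close> have disjoint
    ranges.\<close>
  define \<beta> where "\<beta> y =
    (if y \<in> xv ` tpl_nv N t then Some (Obj (the_elem (b (vty V y))))
     else if y \<in> lv ` tpl_var N t then Some (Lst (us (vty V y))) else None)" for y
  have "T1_binding xv lv N t b \<beta>"
    using us by (auto simp: T1_binding_def \<beta>_def dom_def image_iff)
  then show ?thesis by blast
qed

section \<open>Emitting the initial marking and consuming the final one\<close>

lemma T1_marking_M_init_insert:
  "T1_marking (M_init ot N (insert u A)) p =
     T1_marking (M_init ot N A) p \<union> (if p = play_place N (ot u) then {[u]} else {})"
  by (auto simp: T1_marking_def M_init_def)

lemma T1_marking_M_final_insert: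
  "T1_marking (M_final ot N (insert u A)) p =
     T1_marking (M_final ot N A) p \<union> (if p = stop_place N (ot u) then {[u]} else {})"
  by (auto simp: T1_marking_def M_final_def)

text \<open>The marking for \<open>A\<close> contains objects of \<open>A\<close> only, so
  \<open>u\<close> is fresh for it.\<close>

lemma emit_step:
  assumes "u \<notin> A" "u \<in> Obs"
  shows "opid_step ot V N' Obs (T1_marking (M_init ot N A)) (Emit (ot u)) [fv (ot u) \<mapsto> Obj u]
    (T1_marking (M_init ot N (insert u A)))"
proof -
  have "vars_in N' (Emit (ot u)) = {}" "vars_out N' (Emit (ot u)) = {fv (ot u)}"
    by (auto simp: in_vars_in_iff in_vars_out_iff T1_def split: if_splits)
  moreover have "u \<notin> marking_objects (T1_marking (M_init ot N A))"
    using assms by (auto simp: marking_objects_def T1_marking_def M_init_def)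
  ultimately have "opid_binding ot V N' (T1_marking (M_init ot N A)) (Emit (ot u))
      [fv (ot u) \<mapsto> Obj u]"
    by (auto simp: opid_binding_def split: if_splits)
  then show ?thesis
    using assms opid_marking_T1_marking[OF ocpn_marking_M_init]
    by (auto simp: opid_step_def T1_marking_M_init_insert fun_eq_iff T1_def inst_arc_def
        in_inst_singleton)
qed

lemma consume_step:
  assumes "u \<notin> A" "u \<in> Obs"
  shows "opid_step ot V N' Obs (T1_marking (M_final ot N (insert u A))) (Consume (ot u))
    [xv (ot u) \<mapsto> Obj u] (T1_marking (M_final ot N A))"
proof -
  have "vars_in N' (Consume (ot u)) = {xv (ot u)}" "vars_out N' (Consume (ot u)) = {}"
    by (auto simp: in_vars_in_iff in_vars_out_iff T1_def split: if_splits)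
  then have "opid_binding ot V N' (T1_marking (M_final ot N (insert u A))) (Consume (ot u))
      [xv (ot u) \<mapsto> Obj u]"
    by (auto simp: opid_binding_def split: if_splits)
  \<comment> \<open>Removing the token of \<open>u\<close> thus gives back exactly the marking for
    \<open>A\<close>.\<close>
  moreover have "[u] \<notin> T1_marking (M_final ot N A) p" for p
    using assms by (simp add: M_final_def)
  ultimately show ?thesis
    using assms opid_marking_T1_marking[OF ocpn_marking_M_final, of "insert u A"]
    by (auto simp: opid_step_def T1_marking_M_final_insert fun_eq_iff T1_def inst_arc_def
        in_inst_singleton)
qed

lemma emitting_sequence:
  assumes "finite A" "A \<subseteq> Obs"
  shows "opid_steps ot V N' Obs (range Emit) empty_marking (T1_marking (M_init ot N A))"
  using assms
proof (induction A rule: finite_induct)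
  case empty
  have "T1_marking (M_init ot N {}) = empty_marking"
    by (auto simp: T1_marking_def M_init_def empty_marking_def)
  then show ?case by (simp add: opid_steps_def)
next
  case (insert u A)
  then show ?case
    using emit_step[of u A Obs] unfolding opid_steps_def
    \<comment> \<open>The inserted object is emitted last, so the step is appended.\<close>
    by (auto intro: rtranclp.rtrancl_into_rtrancl)
qed

lemma collapsing_sequence:
  assumes "finite A" "A \<subseteq> Obs"
  shows "opid_steps ot V N' Obs (range Consume) (T1_marking (M_final ot N A)) empty_marking"
  using assms
proof (induction A rule: finite_induct)
  case empty
  have "T1_marking (M_final ot N {}) = empty_marking"
    by (auto simp: T1_marking_def M_final_def empty_marking_def)
  then show ?case by (simp add: opid_steps_def)
next
  case (insert u A)
  then show ?case
    using consume_step[of u A Obs] unfolding opid_steps_def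
    \<comment> \<open>The inserted object is consumed first, so the step is prepended.\<close>
    by (auto intro: converse_rtranclp_into_rtranclp)
qed

end

text \<open>The OCPN data \<open>M\<close>, \<open>t\<close>, \<open>b\<close> are fixed, and the
  existential form follows by quantifying both sides over them. The endpoint conditions stand on
  both sides, since an emitting sequence over \<open>Obs\<close> may emit only some of its
  objects.\<close>

theorem theorem1:
  fixes ot :: "'o \<Rightarrow> 's"
    and Obs :: "'o set"
    and N :: "('n, 's, 'a) ocpn"
    and V :: "('v, 's) variables"
    and xv lv fv :: "'s \<Rightarrow> 'v"
    and N' :: "('n, ('n, 's) t1_trans, 'v, 's, 'a) opid"
    and n :: nat
    and M :: "nat \<Rightarrow> 'n \<times> 'o \<Rightarrow> nat"
    and t :: "nat \<Rightarrow> 'n"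
    and b :: "nat \<Rightarrow> 's \<Rightarrow> 'o set"
  assumes "finite Obs"
    and "accepting_ocpn N"
    and "wf_variables V" and "variable_choice V xv lv fv"
    and "N' = T1 xv lv fv N" and "wf_opid V N'"
    and "\<forall>i\<in>{0..n}. ocpn_marking ot N (M i)"
    and "\<forall>i\<in>{1..n}. binding_execution ot N (t i) (b i)"
  shows
    "(M 0 = M_init ot N Obs \<and> M n = M_final ot N Obs \<and>
      (\<forall>i\<in>{1..n}. ocpn_step ot N (M (i - 1)) (t i) (b i) (M i)))
     \<longleftrightarrow>
     (M 0 = M_init ot N Obs \<and> M n = M_final ot N Obs \<and>
      (\<exists>M' \<beta>.
         opid_steps ot V N' Obs (range Emit) empty_marking (M' 0) \<and>
         (\<forall>i\<in>{1..n}. opid_step ot V N' Obs (M' (i - 1)) (Orig (t i)) (\<beta> i) (M' i)) \<and>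
         opid_steps ot V N' Obs (range Consume) (M' n) empty_marking \<and>
         (\<forall>i\<in>{0..n}. M' i = T1_marking (M i)) \<and>
         (\<forall>i\<in>{1..n}. T1_binding xv lv N (t i) (b i) (\<beta> i))))"
proof -
  interpret T1_translation ot N V xv lv fv
    using assms(2-4) by unfold_locales
  note N' = assms(5) and wfN' = assms(6)[unfolded assms(5)]
  have marking: "ocpn_marking ot N (M i)" if "i \<le> n" for i
    using assms(7) that by simp
  have binding: "binding_execution ot N (t i) (b i)" if "i \<in> {1..n}" for i
    using assms(8) that by blast
  have step_iff: "opid_step ot V N' Obs (T1_marking (M (i - 1))) (Orig (t i)) \<beta> (T1_marking (M i))
      \<longleftrightarrow> ocpn_step ot N (M (i - 1)) (t i) (b i) (M i) \<and> (\<forall>a\<in>ran \<beta>. val_objects a \<subseteq> Obs)"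
    if "i \<in> {1..n}" "T1_binding xv lv N (t i) (b i) \<beta>" for i \<beta>
  proof -
    have "i - 1 \<le> n" "i \<le> n" using that(1) by auto
    then show ?thesis
      unfolding N' using that binding marking by (intro opid_step_Orig_iff) auto
  qed
  show ?thesis (is "?ocpn \<longleftrightarrow> ?init \<and> ?final \<and> (\<exists>M' \<beta>. ?opid M' \<beta>)")
  proof
    assume run: ?ocpn
    then have steps: "ocpn_step ot N (M (i - 1)) (t i) (b i) (M i)" if "i \<in> {1..n}" for i
      using that by blast
    \<comment> \<open>Invariant of the run, starting from the objects of
      \<open>M_init\<close>.\<close>
    have objects: "{u. \<exists>p. M i (p, u) > 0} \<subseteq> Obs" if "i \<le> n" for i
      using that
    proof (induction i)
      case 0
      then show ?case using run by (auto simp: M_init_def)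
    next
      case (Suc i)
      then show ?case using ocpn_step_objects[OF wfN' steps[of "Suc i"]] by force
    qed
    \<comment> \<open>This serves twice: with \<open>finite Obs\<close> it makes the bound sets
      finite, so that they can be listed, and it keeps the OPID bindings over
      \<open>Obs\<close>.\<close>
    have bound: "b i \<sigma> \<subseteq> Obs" if "i \<in> {1..n}" "\<sigma> \<in> tpl N (t i)" for i \<sigma>
    proof -
      have "i - 1 \<le> n" using that(1) by auto
      from objects[OF this] enabled_bound_objects[OF wfN' steps[OF that(1)] that(2)]
      show ?thesis by (rule order_trans[rotated])
    qed
    have "\<exists>\<beta>. T1_binding xv lv N (t i) (b i) \<beta>" if "i \<in> {1..n}" for i
      using T1_binding_exists bound[OF that] finite_subset assms(1) by metis
    then obtain \<beta> where \<beta>: "\<And>i. i \<in> {1..n} \<Longrightarrow> T1_binding xv lv N (t i) (b i) (\<beta> i)"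
      by metis
    have "opid_step ot V N' Obs (T1_marking (M (i - 1))) (Orig (t i)) (\<beta> i) (T1_marking (M i))"
      if i: "i \<in> {1..n}" for i
    proof -
      have "val_objects a \<subseteq> Obs" if "a \<in> ran (\<beta> i)" for a
      proof -
        from that obtain y where "\<beta> i y = Some a" by (auto simp: ran_def)
        then show ?thesis
          using T1_binding_value[OF binding[OF i] \<beta>[OF i]] bound[OF i] by metis
      qed
      then show ?thesis using step_iff[OF i \<beta>[OF i]] steps[OF i] by blast
    qed
    then have "?opid (\<lambda>i. T1_marking (M i)) \<beta>"
      using \<beta> run emitting_sequence[OF assms(1) order_refl]
        collapsing_sequence[OF assms(1) order_refl]
      by (simp add: N')
    then have "\<exists>M' \<beta>. ?opid M' \<beta>" by (intro exI)
    then show "?init \<and> ?final \<and> (\<exists>M' \<beta>. ?opid M' \<beta>)"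
      using run by simp
  next
    assume "?init \<and> ?final \<and> (\<exists>M' \<beta>. ?opid M' \<beta>)"
    then obtain M' \<beta> where ends: ?init ?final and opid: "?opid M' \<beta>" by blast
    \<comment> \<open>Since \<open>M'\<close> is forced to be the translation of \<open>M\<close>,
      each OPID step is read back through \<open>step_iff\<close>.\<close>
    have "ocpn_step ot N (M (i - 1)) (t i) (b i) (M i)" if i: "i \<in> {1..n}" for i
    proof -
      have "M' i = T1_marking (M i)" "M' (i - 1) = T1_marking (M (i - 1))"
        using opid i by auto
      then show ?thesis using opid i step_iff by metis
    qed
    with ends show ?ocpn by blast
  qed
qed

end
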